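(* Let $p_1,p_2,q:[a,b]\to\mathbb{C}$ be continuous, and let $(u_1,v_1)^T$ and $(u_2,v_2)^T$ be two linearly independent (complex-valued) solutions on $[a,b]$ of the homogeneous system $$\begin{cases} v'+p_1(x)u+q(x)v=0, \\ -u'+q(x)u+p_2(x)v=0. \end{cases}$$ Then there exists a linear combination $$\begin{pmatrix} u \\ v \end{pmatrix}=c_1\begin{pmatrix} u_1 \\ v_1 \end{pmatrix}+c_2\begin{pmatrix} u_2 \\ v_2 \end{pmatrix},\qquad c_1,c_2\in\mathbb{C},$$ such that both functions $u$ and $v$ are non-vanishing on $[a,b]$ (i.e. $u(x)\neq0$ and $v(x)\ne0$ for every $x\in[a,b]$).
   Context: Solutions are continuously differentiable functions $[a,b]\to\mathbb{C}^2$; linear independence is over $\mathbb{C}$. *)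

theory Defs
  imports "HOL-Analysis.Analysis"
begin

text \<open>
  A function on \<open>[a,b]\<close> is represented by a total function on the reals of which only the
  values on \<open>{a..b}\<close> matter; accordingly derivatives are taken within \<open>{a..b}\<close>, so they are
  one-sided at the endpoints.
\<close>

definition is_C1_solution ::
  "real \<Rightarrow> real \<Rightarrow> (real \<Rightarrow> complex) \<Rightarrow> (real \<Rightarrow> complex) \<Rightarrow> (real \<Rightarrow> complex)
    \<Rightarrow> (real \<Rightarrow> complex) \<Rightarrow> (real \<Rightarrow> complex) \<Rightarrow> bool"
  where "is_C1_solution a b p1 p2 q u v \<longleftrightarrow>
    (\<exists>u' v'. continuous_on {a..b} u' \<and> continuous_on {a..b} v' \<and>
      (\<forall>x\<in>{a..b}.
        (u has_vector_derivative u' x) (at x within {a..b}) \<and>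
        (v has_vector_derivative v' x) (at x within {a..b}) \<and>
        v' x + p1 x * u x + q x * v x = 0 \<and>
        - u' x + q x * u x + p2 x * v x = 0))"

text \<open>
  Linear independence over the complex numbers of \<open>(u1, v1)\<close> and \<open>(u2, v2)\<close> as elements of the
  space of functions from \<open>[a,b]\<close> to pairs of complex numbers. The library predicate
  \<open>independent\<close> is not used since it would compare values outside \<open>[a,b]\<close> as well.
\<close>

definition lin_indep_pair_on ::
  "real set \<Rightarrow> (real \<Rightarrow> complex) \<Rightarrow> (real \<Rightarrow> complex)
    \<Rightarrow> (real \<Rightarrow> complex) \<Rightarrow> (real \<Rightarrow> complex) \<Rightarrow> bool"
  where "lin_indep_pair_on S u1 v1 u2 v2 \<longleftrightarrow>
    (\<forall>c1 c2 :: complex.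
      (\<forall>x\<in>S. c1 * u1 x + c2 * u2 x = 0 \<and> c1 * v1 x + c2 * v2 x = 0) \<longrightarrow> c1 = 0 \<and> c2 = 0)"

end

theory Submission
  imports Defs
begin

text \<open>
  A solution that vanishes at one point vanishes identically, so linear independence makes
  \<open>u1\<close> and \<open>u2\<close> have no common zero, and likewise \<open>v1\<close> and \<open>v2\<close>. Take \<open>c2 = 1\<close>. The values
  of \<open>c1\<close> that give \<open>u\<close> a zero are then the values of the differentiable curve \<open>- u2 / u1\<close>, those
  that give \<open>v\<close> a zero are the values of \<open>- v2 / v1\<close>. Both curves are planar null sets, so some
  complex number avoids them.
\<close>

text \<open>A Gronwall argument for uniqueness: by Cauchy-Schwarz the derivative of
  \<open>g y \<bullet> g y\<close> is at most \<open>2 * K * (g y \<bullet> g y)\<close> in absolute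
  value, so an exponential weight makes this square monotone, and its zero at \<open>z\<close>
  spreads to both sides.\<close>

lemma eq_zero_of_norm_derivative_le:
  fixes g g' :: "real \<Rightarrow> 'a::real_inner"
  assumes der: "\<And>x. x \<in> {a..b} \<Longrightarrow> (g has_vector_derivative g' x) (at x within {a..b})"
    and bound: "\<And>x. x \<in> {a..b} \<Longrightarrow> norm (g' x) \<le> K * norm (g x)"
    and z: "z \<in> {a..b}" "g z = 0" and x: "x \<in> {a..b}"
  shows "g x = 0"
proof -
  \<comment> \<open>The parameter \<open>s\<close> is a sign: the weight makes \<open>h 1\<close>
    nondecreasing and \<open>h (- 1)\<close> nonincreasing, so one derivative computation serves
    both directions.\<close>
  define h where "h s y = (g y \<bullet> g y) * exp (s * (2 * K) * y)" for s y
  define h' where "h' s y = 2 * (g y \<bullet> g' y + s * K * (g y \<bullet> g y)) * exp (s * (2 * K) * y)" for s y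
  have h: "(h s has_real_derivative h' s y) (at y within {a..b})" if "y \<in> {a..b}" for s y
  proof -
    have "((\<lambda>y. g y \<bullet> g y) has_derivative (\<lambda>t. g y \<bullet> (t *\<^sub>R g' y) + (t *\<^sub>R g' y) \<bullet> g y))
        (at y within {a..b})"
      using der[OF that] unfolding has_vector_derivative_def by (intro has_derivative_inner)
    then have "((\<lambda>y. g y \<bullet> g y) has_real_derivative 2 * (g y \<bullet> g' y)) (at y within {a..b})"
      unfolding has_field_derivative_def
      by (rule has_derivative_eq_rhs) (auto simp: fun_eq_iff inner_commute)
    then show ?thesis
      unfolding h_def h'_def
      by (auto intro!: derivative_eq_intros simp: algebra_simps)
  qed
  have cont: "continuous_on {c..d} (h s)" if "{c..d} \<subseteq> {a..b}" for s c d
    using h that by (meson DERIV_continuous continuous_on_eq_continuous_within continuous_on_subset)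
  \<comment> \<open>Two-sided derivatives are available only in the interior, hence the monotonicity
    rules below that ask for derivatives on an open interval and continuity on its closure.\<close>
  have h_at: "(h s has_real_derivative h' s y) (at y)" if "a < y" "y < b" for s y
    using h[of y s] that by (simp add: at_within_Icc_at)
  have inner_le: "\<bar>g y \<bullet> g' y\<bar> \<le> K * (g y \<bullet> g y)" if "y \<in> {a..b}" for y
  proof -
    have "\<bar>g y \<bullet> g' y\<bar> \<le> norm (g y) * norm (g' y)"
      by (rule Cauchy_Schwarz_ineq2)
    also have "\<dots> \<le> norm (g y) * (K * norm (g y))"
      using bound[OF that] by (simp add: mult_left_mono)
    finally show ?thesis
      by (simp add: dot_square_norm power2_eq_square algebra_simps)
  qed
  \<comment> \<open>The sign is chosen so that \<open>h s\<close> does not decrease on the way from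
    \<open>x\<close> to \<open>z\<close>; there it is 0, and the positive weight then
    cancels.\<close>
  have "\<exists>s. h s x \<le> h s z"
  proof (cases x z rule: linorder_cases)
    case less
    have "h 1 x \<le> h 1 z"
    proof (rule DERIV_nonneg_imp_increasing_open[where f = "h 1"])
      fix y assume y: "x < y" "y < z"
      then have "0 \<le> h' 1 y"
        using inner_le[of y] x z by (auto simp: h'_def intro!: mult_nonneg_nonneg)
      then show "\<exists>d. DERIV (h 1) y :> d \<and> 0 \<le> d"
        using h_at[of y 1] y x z by auto
    qed (use less cont x z in auto)
    then show ?thesis ..
  next
    case greater
    have "h (- 1) x \<le> h (- 1) z"
    proof (rule DERIV_nonpos_imp_decreasing_open[where f = "h (- 1)"])
      fix y assume y: "z < y" "y < x"
      then have "h' (- 1) y \<le> 0"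
        using inner_le[of y] x z by (auto simp: h'_def intro!: mult_nonpos_nonneg)
      then show "\<exists>d. DERIV (h (- 1)) y :> d \<and> d \<le> 0"
        using h_at[of y "- 1"] y x z by auto
    qed (use greater cont x z in auto)
    then show ?thesis ..
  qed auto
  then have "g x \<bullet> g x \<le> 0"
    using z by (auto simp: h_def mult_le_0_iff)
  then show ?thesis
    by (metis inner_gt_zero_iff not_le)
qed

lemma is_C1_solution_lincomb:
  assumes "is_C1_solution a b p1 p2 q u1 v1" "is_C1_solution a b p1 p2 q u2 v2"
  shows "is_C1_solution a b p1 p2 q (\<lambda>x. c1 * u1 x + c2 * u2 x) (\<lambda>x. c1 * v1 x + c2 * v2 x)"
proof -
  obtain u1' v1' where 1: "continuous_on {a..b} u1'" "continuous_on {a..b} v1'"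
    "\<And>x. x \<in> {a..b} \<Longrightarrow> (u1 has_vector_derivative u1' x) (at x within {a..b}) \<and>
      (v1 has_vector_derivative v1' x) (at x within {a..b}) \<and>
      v1' x + p1 x * u1 x + q x * v1 x = 0 \<and> - u1' x + q x * u1 x + p2 x * v1 x = 0"
    using assms(1) unfolding is_C1_solution_def by blast
  obtain u2' v2' where 2: "continuous_on {a..b} u2'" "continuous_on {a..b} v2'"
    "\<And>x. x \<in> {a..b} \<Longrightarrow> (u2 has_vector_derivative u2' x) (at x within {a..b}) \<and>
      (v2 has_vector_derivative v2' x) (at x within {a..b}) \<and>
      v2' x + p1 x * u2 x + q x * v2 x = 0 \<and> - u2' x + q x * u2 x + p2 x * v2 x = 0"
    using assms(2) unfolding is_C1_solution_def by blast
  show ?thesis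
    unfolding is_C1_solution_def
  proof (intro exI conjI ballI)
    show "continuous_on {a..b} (\<lambda>x. c1 * u1' x + c2 * u2' x)"
      "continuous_on {a..b} (\<lambda>x. c1 * v1' x + c2 * v2' x)"
      using 1 2 by (auto intro!: continuous_intros)
  next
    fix x assume x: "x \<in> {a..b}"
    show "((\<lambda>x. c1 * u1 x + c2 * u2 x) has_vector_derivative c1 * u1' x + c2 * u2' x) (at x within {a..b})"
      "((\<lambda>x. c1 * v1 x + c2 * v2 x) has_vector_derivative c1 * v1' x + c2 * v2' x) (at x within {a..b})"
      using 1(3)[OF x] 2(3)[OF x]
      by (auto intro!: has_vector_derivative_add has_vector_derivative_mult_right)
    have "c1 * v1' x + c2 * v2' x + p1 x * (c1 * u1 x + c2 * u2 x) + q x * (c1 * v1 x + c2 * v2 x)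
        = c1 * (v1' x + p1 x * u1 x + q x * v1 x) + c2 * (v2' x + p1 x * u2 x + q x * v2 x)"
      by (simp add: algebra_simps)
    then show "c1 * v1' x + c2 * v2' x + p1 x * (c1 * u1 x + c2 * u2 x)
        + q x * (c1 * v1 x + c2 * v2 x) = 0"
      using 1(3)[OF x] 2(3)[OF x] by simp
    have "- (c1 * u1' x + c2 * u2' x) + q x * (c1 * u1 x + c2 * u2 x) + p2 x * (c1 * v1 x + c2 * v2 x)
        = c1 * (- u1' x + q x * u1 x + p2 x * v1 x) + c2 * (- u2' x + q x * u2 x + p2 x * v2 x)"
      by (simp add: algebra_simps)
    then show "- (c1 * u1' x + c2 * u2' x) + q x * (c1 * u1 x + c2 * u2 x)
        + p2 x * (c1 * v1 x + c2 * v2 x) = 0"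
      using 1(3)[OF x] 2(3)[OF x] by simp
  qed
qed

text \<open>Continuous coefficients are bounded on the compact interval, so the linear system bounds
  the derivative of the pair \<open>(u, v)\<close> by a constant times its norm.\<close>

lemma is_C1_solution_eq_zero:
  assumes cont: "continuous_on {a..b} p1" "continuous_on {a..b} p2" "continuous_on {a..b} q"
    and sol: "is_C1_solution a b p1 p2 q u v"
    and z: "z \<in> {a..b}" "u z = 0" "v z = 0" and x: "x \<in> {a..b}"
  shows "u x = 0 \<and> v x = 0"
proof -
  obtain u' v' where s: "\<And>x. x \<in> {a..b} \<Longrightarrow> (u has_vector_derivative u' x) (at x within {a..b}) \<and>
      (v has_vector_derivative v' x) (at x within {a..b}) \<and>
      v' x + p1 x * u x + q x * v x = 0 \<and> - u' x + q x * u x + p2 x * v x = 0"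
    using sol unfolding is_C1_solution_def by blast
  have bdd: "\<exists>B. \<forall>y\<in>{a..b}. norm (p y) \<le> B" if "continuous_on {a..b} p" for p :: "real \<Rightarrow> complex"
    using compact_imp_bounded[OF compact_continuous_image[OF that compact_Icc]]
    by (auto simp: bounded_iff)
  obtain B1 B2 Q where B: "\<And>y. y \<in> {a..b} \<Longrightarrow> norm (p1 y) \<le> B1"
      "\<And>y. y \<in> {a..b} \<Longrightarrow> norm (p2 y) \<le> B2" "\<And>y. y \<in> {a..b} \<Longrightarrow> norm (q y) \<le> Q"
    using bdd[OF cont(1)] bdd[OF cont(2)] bdd[OF cont(3)] by blast
  have "(u x, v x) = 0"
  \<comment> \<open>\<open>K\<close> adds up one bound per coefficient in the two equations;
    \<open>q\<close> occurs in both, hence \<open>2 * Q\<close>.\<close>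
  proof (rule eq_zero_of_norm_derivative_le[where a = a and b = b and z = z
        and g = "\<lambda>x. (u x, v x)" and g' = "\<lambda>x. (u' x, v' x)" and K = "B1 + B2 + 2 * Q"])
    fix y assume y: "y \<in> {a..b}"
    show "((\<lambda>x. (u x, v x)) has_vector_derivative (u' y, v' y)) (at y within {a..b})"
      using s[OF y] by (auto intro!: has_vector_derivative_Pair)
    have eqs: "u' y = q y * u y + p2 y * v y" "v' y = - (p1 y * u y) - q y * v y"
      using s[OF y] by (auto simp: algebra_simps eq_neg_iff_add_eq_0)
    let ?n = "norm (u y, v y)"
    have un: "norm (u y) \<le> ?n" and vn: "norm (v y) \<le> ?n"
      using norm_fst_le[of "u y" "v y"] norm_snd_le[of "v y" "u y"] by auto
    have m: "norm (c * w) \<le> C * ?n" if "norm c \<le> C" "norm w \<le> ?n" for c w :: complex and C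
      unfolding norm_mult using that by (intro mult_mono) (auto intro: order_trans[OF norm_ge_zero])
    have "norm (u' y, v' y) \<le> norm (u' y) + norm (v' y)"
      by (rule norm_Pair_le)
    also have "\<dots> \<le> (norm (q y * u y) + norm (p2 y * v y)) + (norm (p1 y * u y) + norm (q y * v y))"
      unfolding eqs by (intro add_mono norm_triangle_ineq order_trans[OF norm_triangle_ineq4]) auto
    also have "\<dots> \<le> (Q * ?n + B2 * ?n) + (B1 * ?n + Q * ?n)"
      using B y un vn by (intro add_mono m) auto
    finally show "norm (u' y, v' y) \<le> (B1 + B2 + 2 * Q) * ?n"
      by (simp add: algebra_simps)
  qed (use z x in \<open>auto simp: zero_prod_def\<close>)
  then show ?thesis
    by (simp add: zero_prod_def)
qed

lemma lin_indep_pair_on_no_common_zero: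
  assumes cont: "continuous_on {a..b} p1" "continuous_on {a..b} p2" "continuous_on {a..b} q"
    and sol: "is_C1_solution a b p1 p2 q u1 v1" "is_C1_solution a b p1 p2 q u2 v2"
    and indep: "lin_indep_pair_on {a..b} u1 v1 u2 v2"
    and x: "x \<in> {a..b}"
  shows "u1 x \<noteq> 0 \<or> u2 x \<noteq> 0" "v1 x \<noteq> 0 \<or> v2 x \<noteq> 0"
proof -
  \<comment> \<open>Cancelling both components at the single point \<open>x\<close> already makes
    the combination vanish on all of \<open>{a..b}\<close>.\<close>
  have trivial: "c1 = 0 \<and> c2 = 0"
    if "c1 * u1 x + c2 * u2 x = 0" "c1 * v1 x + c2 * v2 x = 0" for c1 c2
    using is_C1_solution_eq_zero[OF cont is_C1_solution_lincomb[OF sol, of c1 c2] x that] indep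
    unfolding lin_indep_pair_on_def by blast
  show "u1 x \<noteq> 0 \<or> u2 x \<noteq> 0"
    \<comment> \<open>If \<open>u1 x = u2 x = 0\<close>, the coefficients \<open>v2 x\<close> and
      \<open>- v1 x\<close> cancel both components at \<open>x\<close>, so \<open>v1 x = 0\<close>.
      Then the coefficients 1 and 0 cancel both as well, which is absurd.\<close>
    using trivial[of "v2 x" "- v1 x"] trivial[of 1 0] by auto
  show "v1 x \<noteq> 0 \<or> v2 x \<noteq> 0"
    using trivial[of "u2 x" "- u1 x"] trivial[of 1 0] by auto
qed

lemma negligible_zero_coefficients:
  fixes f g :: "real \<Rightarrow> complex"
  assumes "f differentiable_on S" "g differentiable_on S"
    and nz: "\<And>x. x \<in> S \<Longrightarrow> f x \<noteq> 0 \<or> g x \<noteq> 0"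
  shows "negligible {c. \<exists>x\<in>S. c * f x + g x = 0}"
proof -
  let ?T = "{x \<in> S. f x \<noteq> 0}"
  have "negligible ((\<lambda>x. - g x / f x) ` ?T)"
  proof (rule negligible_differentiable_image_lowdim)
    show "(\<lambda>x. - g x / f x) differentiable_on ?T"
      unfolding divide_inverse
    proof (intro differentiable_on_mult)
      have "f differentiable_on ?T" "g differentiable_on ?T"
        using assms(1,2) by (auto intro: differentiable_on_subset)
      then show "(\<lambda>x. - g x) differentiable_on ?T" "(\<lambda>x. inverse (f x)) differentiable_on ?T"
        by (auto simp: differentiable_on_def intro!: differentiable_inverse)
    qed
  \<comment> \<open>What remains is that the real line has smaller real dimension than the complex
    plane.\<close>
  qed simp
  moreover have "{c. \<exists>x\<in>S. c * f x + g x = 0} \<subseteq> (\<lambda>x. - g x / f x) ` ?T"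
  proof safe
    fix c x assume x: "x \<in> S" "c * f x + g x = 0"
    with nz[of x] have "f x \<noteq> 0"
      by auto
    moreover from this x have "c = - g x / f x"
      by (simp add: field_simps eq_neg_iff_add_eq_0)
    ultimately show "c \<in> (\<lambda>x. - g x / f x) ` ?T"
      using x by blast
  qed
  ultimately show ?thesis
    by (rule negligible_subset)
qed

theorem proposition2p9:
  fixes a b :: real
    and p1 p2 q u1 v1 u2 v2 :: "real \<Rightarrow> complex"
  assumes "a < b"
    and "continuous_on {a..b} p1"
    and "continuous_on {a..b} p2"
    and "continuous_on {a..b} q"
    and "is_C1_solution a b p1 p2 q u1 v1"
    and "is_C1_solution a b p1 p2 q u2 v2"
    and "lin_indep_pair_on {a..b} u1 v1 u2 v2"
  shows "\<exists>c1 c2 :: complex. \<forall>x\<in>{a..b}.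
           c1 * u1 x + c2 * u2 x \<noteq> 0 \<and> c1 * v1 x + c2 * v2 x \<noteq> 0"
proof -
  have diff: "u differentiable_on {a..b}" "v differentiable_on {a..b}"
    if "is_C1_solution a b p1 p2 q u v" for u v
    using that unfolding is_C1_solution_def differentiable_on_def differentiable_def
      has_vector_derivative_def by blast+
  \<comment> \<open>With second coefficient 1, \<open>?Z f g\<close> collects the first coefficients
    to be avoided.\<close>
  let ?Z = "\<lambda>f g. {c. \<exists>x\<in>{a..b}. c * f x + g x = 0} :: complex set"
  have "negligible (?Z u1 u2)" "negligible (?Z v1 v2)"
    using lin_indep_pair_on_no_common_zero[OF assms(2-7)] diff[OF assms(5)] diff[OF assms(6)]
    by (auto intro!: negligible_zero_coefficients)
  then have "negligible (?Z u1 u2 \<union> ?Z v1 v2)"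
    by (rule negligible_Un)
  then have "?Z u1 u2 \<union> ?Z v1 v2 \<noteq> UNIV"
    by (rule contrapos_pn) (simp only: non_negligible_UNIV not_False_eq_True)
  then obtain c where "c \<notin> ?Z u1 u2 \<union> ?Z v1 v2"
    by blast
  then have "\<forall>x\<in>{a..b}. c * u1 x + 1 * u2 x \<noteq> 0 \<and> c * v1 x + 1 * v2 x \<noteq> 0"
    by auto
  then show ?thesis
    by blast
qed

end
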